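(* Let $t\ge 1$ be an integer and, for each $i\in\{1,\ldots,t\}$, let $\{A^i_n\}_{n=0}^\infty$ be a periodic sequence of positive real numbers with prime period $p_i$. Let $\{x_n\}_{n=-t}^\infty$ be a positive solution of $$x_n=\max\left\{\frac{A^1_{n-1}}{x_{n-1}},\frac{A^2_{n-1}}{x_{n-2}},\ldots,\frac{A^t_{n-1}}{x_{n-t}}\right\},\qquad n=1,2,\ldots.$$ If there exists $i\in\{1,\ldots,t\}$ with $\gcd(t+1,\,p_i\,p_{t+1-i})=1$, then $\{x_n\}_{n=-t}^\infty$ is bounded and persists.
   Context: A positive solution is a sequence $\{x_n\}_{n=-t}^{\infty}$ of positive real numbers (with arbitrary positive initial values) satisfying the recurrence for every $n\ge 1$. The prime period of a periodic sequence is its minimal period. A positive sequence $\{x_n\}_{n=-t}^\infty$ is bounded if there is a constant $M>0$ with $0<x_n\le M$ for all $n\ge -t$; it persists if there is a constant $m>0$ with $m\le x_n$ for all $n\ge -t$. *)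

theory Defs
  imports Complex_Main
begin

definition is_period :: "(nat \<Rightarrow> 'a) \<Rightarrow> nat \<Rightarrow> bool" where
  "is_period a p \<longleftrightarrow> p > 0 \<and> (\<forall>n. a (n + p) = a n)"

definition prime_period :: "(nat \<Rightarrow> 'a) \<Rightarrow> nat \<Rightarrow> bool" where
  "prime_period a p \<longleftrightarrow> is_period a p \<and> (\<forall>q. is_period a q \<longrightarrow> p \<le> q)"

text \<open>
  A sequence indexed by the integers from \<open>- t\<close> on is a total function on the integers of
  which only the values at arguments \<open>\<ge> - t\<close> are ever constrained.  The term \<open>x (- t)\<close>
  belongs to the sequence although the recurrence, whose first instance computes \<open>x 1\<close>
  from \<open>x 0, \<dots>, x (1 - t)\<close>, never refers to it.  The superscript of the coefficient
  sequence is the first argument of \<open>A\<close>.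
\<close>

definition positive_solution ::
    "nat \<Rightarrow> (nat \<Rightarrow> nat \<Rightarrow> real) \<Rightarrow> (int \<Rightarrow> real) \<Rightarrow> bool" where
  "positive_solution t A x \<longleftrightarrow>
     (\<forall>n \<ge> - int t. x n > 0) \<and>
     (\<forall>n::nat. n \<ge> 1 \<longrightarrow>
        x (int n) = Max ((\<lambda>i. A i (n - 1) / x (int n - int i)) ` {1..t}))"

definition bounded_seq :: "nat \<Rightarrow> (int \<Rightarrow> real) \<Rightarrow> bool" where
  "bounded_seq t x \<longleftrightarrow> (\<exists>M>0. \<forall>n \<ge> - int t. 0 < x n \<and> x n \<le> M)"

definition persists :: "nat \<Rightarrow> (int \<Rightarrow> real) \<Rightarrow> bool" where
  "persists t x \<longleftrightarrow> (\<exists>m>0. \<forall>n \<ge> - int t. m \<le> x n)"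

end

theory Submission
  imports Defs "HOL-Number_Theory.Cong"
begin

text \<open>
  Put \<open>y n = ln (x n)\<close> and let \<open>a i n\<close> be the logarithm of the \<open>i\<close>-th coefficient.  The recurrence
  says that \<open>a i (n - 1) \<le> y n + y (n - i)\<close> for \<open>1 \<le> i \<le> t\<close>, with equality for at least one \<open>i\<close>.
  So two terms at distance at most \<open>t\<close> cannot both be very negative, and a
  lower bound on \<open>y\<close> yields an upper bound.

  Suppose that \<open>y n\<close> is very negative, and let \<open>s = t + 1\<close>.  Going from \<open>n\<close> to \<open>n - i\<close> by the
  inequality and from there to \<open>n - i - j\<close> by an index \<open>j\<close> that attains the maximum, one arrives at
  another very negative term.  As such terms are more than \<open>t\<close> apart, taking \<open>i = 1\<close>
  shows that \<open>y (n - s)\<close> is very negative, and then every \<open>i\<close> leads to that same term, that is,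
  \<open>j = s - i\<close>.  Hence, for every \<open>i\<close>,
  \<open>y n \<ge> y (n - s) + a i (n - 1) - a (s - i) (n - 1 - i)\<close>
  (lemma \<open>controlled_descent_from_very_negative\<close>).

  If the periods of \<open>a i\<close> and \<open>a (s - i)\<close> are coprime to \<open>s\<close>, then steps of length \<open>s\<close> run evenly
  through the residues modulo each period, so that the increments above average to the
  difference of the mean values of \<open>a i\<close> and \<open>a (s - i)\<close>.  The hypothesis is symmetric under
  exchanging \<open>i\<close> and \<open>s - i\<close>, so this difference may be taken nonnegative.  The fluctuation around
  the average is the increment of a bounded potential (lemma \<open>bounded_potential_of_periodic\<close>).
  So, up to a bounded error, \<open>y\<close> does not decrease in steps of
  length \<open>s\<close> while it is very negative, and therefore it is bounded below.
\<close>

section \<open>Periodic sequences along arithmetic progressions\<close>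

lemma is_period_mod:
  assumes "is_period b p"
  shows "b (n mod p) = b n"
proof -
  have "b (m + k * p) = b m" for m k
  proof (induction k)
    case (Suc k)
    have "b (m + Suc k * p) = b ((m + k * p) + p)"
      by (simp add: algebra_simps)
    with assms Suc show ?case
      by (simp add: is_period_def)
  qed simp
  from this[of "n mod p" "n div p"] show ?thesis
    by simp
qed

lemma finite_range_of_period:
  assumes "is_period b p"
  shows "finite (range b)"
proof (rule finite_subset)
  show "range b \<subseteq> b ` {..<p}"
  proof
    fix v
    assume "v \<in> range b"
    then obtain n where "v = b (n mod p)"
      using is_period_mod[OF assms] by auto
    moreover have "n mod p < p"
      using assms by (simp add: is_period_def)
    ultimately show "v \<in> b ` {..<p}"
      by auto
  qed
qed simp

lemma sum_period_along_progression:
  fixes b :: "nat \<Rightarrow> 'a::comm_monoid_add"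
  assumes "is_period b p" and "coprime s p"
  shows "(\<Sum>k<p. b (n + k * s)) = (\<Sum>k<p. b k)"
proof -
  define f where "f k = (n + k * s) mod p" for k
  have "p > 0"
    using assms(1) by (simp add: is_period_def)
  have "inj_on f {..<p}"
  proof (rule inj_onI)
    fix k l
    assume "k \<in> {..<p}" "l \<in> {..<p}" "f k = f l"
    then have "[n + k * s = n + l * s] (mod p)"
      by (simp add: f_def cong_def)
    then have "[k = l] (mod p)"
      using assms(2) by (simp add: cong_add_lcancel_nat cong_mult_rcancel_nat)
    with \<open>k \<in> {..<p}\<close> \<open>l \<in> {..<p}\<close> show "k = l"
      by (simp add: cong_def)
  qed
  moreover have "f ` {..<p} \<subseteq> {..<p}"
    using \<open>p > 0\<close> by (auto simp: f_def)
  ultimately have "bij_betw f {..<p} {..<p}"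
    by (simp add: bij_betw_def endo_inj_surj)
  then have "(\<Sum>k<p. b (f k)) = (\<Sum>k<p. b k)"
    by (rule sum.reindex_bij_betw)
  then show ?thesis
    by (simp add: f_def is_period_mod[OF assms(1)])
qed

text \<open>
  The weights \<open>k\<close> in the potential \<open>\<phi> n = (\<Sum>k<p. k * b (n + k * s)) / p\<close> make the shift by \<open>s\<close>
  telescope: it lowers every weight by one, except that the new last term \<open>b (n + p * s) = b n\<close>
  enters with weight \<open>p - 1\<close>.  What is subtracted is the mean of \<open>b\<close> over the progression, and by
  coprimality this is the mean over a period.
\<close>

lemma bounded_potential_of_periodic:
  fixes b :: "nat \<Rightarrow> real"
  assumes "is_period b p" and "coprime s p"
  obtains \<phi> B where "\<And>n. \<phi> (n + s) = \<phi> n + b n - (\<Sum>k<p. b k) / real p"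
    and "\<And>n. \<bar>\<phi> n\<bar> \<le> B"
proof
  define \<phi> where "\<phi> n = (\<Sum>k<p. real k * b (n + k * s)) / real p" for n
  have p: "p > 0" and per: "b (n + p) = b n" for n
    using assms(1) by (auto simp: is_period_def)
  show "\<phi> (n + s) = \<phi> n + b n - (\<Sum>k<p. b k) / real p" for n
  proof -
    define g where "g k = b (n + k * s)" for k
    have gp: "g p = g 0"
      using is_period_mod[OF assms(1), of "n + p * s"] is_period_mod[OF assms(1), of n]
      by (simp add: g_def)
    have tele: "(\<Sum>k<m. real k * g (Suc k)) = (\<Sum>k<m. real k * g k) + real m * g m - (\<Sum>k<m. g (Suc k))"
      for m
      by (induction m) (simp_all add: algebra_simps)
    have "(\<Sum>k<p. g (Suc k)) = (\<Sum>k<p. g k)"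
      using sum.lessThan_Suc_shift[of g p] gp by simp
    also have "\<dots> = (\<Sum>k<p. b k)"
      unfolding g_def by (rule sum_period_along_progression[OF assms])
    finally have "(\<Sum>k<p. real k * g (Suc k)) = (\<Sum>k<p. real k * g k) + real p * b n - (\<Sum>k<p. b k)"
      using tele[of p] gp by (simp add: g_def)
    moreover have "\<phi> (n + s) = (\<Sum>k<p. real k * g (Suc k)) / real p"
      by (simp add: \<phi>_def g_def algebra_simps)
    moreover have "\<phi> n = (\<Sum>k<p. real k * g k) / real p"
      by (simp add: \<phi>_def g_def)
    ultimately show ?thesis
      using p by (simp add: field_simps)
  qed
  have "is_period \<phi> p"
  proof -
    have "b (n + p + k * s) = b (n + k * s)" for n k
      using per[of "n + k * s"] by (simp add: algebra_simps)
    with p show ?thesis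
      by (simp add: is_period_def \<phi>_def)
  qed
  then have "finite (range (\<lambda>n. \<bar>\<phi> n\<bar>))"
    using finite_imageI[OF finite_range_of_period, of \<phi> p abs] by (simp add: image_image)
  then show "\<bar>\<phi> n\<bar> \<le> Max (range (\<lambda>n. \<bar>\<phi> n\<bar>))" for n
    by simp
qed

section \<open>The additive form of the recurrence\<close>

text \<open>
  Let \<open>j\<close> attain the maximum at \<open>n - i\<close>.  Then \<open>y (n - i - j) \<le> y n + 2 * C\<close>, and by the case
  \<open>i = 1\<close> also \<open>y (n - (t + 1)) \<le> y n + 2 * C\<close>, whereas the values at two places at distance
  between \<open>1\<close> and \<open>t\<close> add up to at least \<open>- C\<close>.  If \<open>n - i - j\<close> is that close to \<open>n\<close>, this gives
  \<open>y n \<ge> - 3 * C / 2\<close>; if it is that close to \<open>n - (t + 1)\<close>, it gives \<open>y n \<ge> - 5 * C / 2\<close>.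
  Below \<open>- 3 * C\<close> only \<open>i + j = t + 1\<close> remains.
\<close>

lemma controlled_descent_from_very_negative:
  fixes y :: "int \<Rightarrow> real" and a :: "nat \<Rightarrow> nat \<Rightarrow> real"
  assumes ineq: "\<And>n i. n \<ge> 1 \<Longrightarrow> i \<in> {1..t} \<Longrightarrow> a i (n - 1) \<le> y (int n) + y (int n - int i)"
    and attained: "\<And>n. n \<ge> 1 \<Longrightarrow> \<exists>i\<in>{1..t}. y (int n) = a i (n - 1) - y (int n - int i)"
    and bound: "\<And>i n. i \<in> {1..t} \<Longrightarrow> \<bar>a i n\<bar> \<le> C"
    and n: "n \<ge> t + 2" and i: "i \<in> {1..t}" and neg: "y (int n) < - 3 * C"
  shows "y (int n) \<ge> y (int n - int (t + 1)) + a i (n - 1) - a (t + 1 - i) (n - 1 - i)"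
proof -
  have C: "C \<ge> 0"
    using bound[OF i, of 0] by linarith
  have two_steps: "\<exists>j\<in>{1..t}. \<not> i + j \<le> t \<and>
      y (int n) \<ge> y (int n - int (i + j)) + a i (n - 1) - a j (n - 1 - i)"
    if i: "i \<in> {1..t}" for i
  proof -
    have "n - i \<ge> 1"
      using n i by auto
    from attained[OF this] obtain j where j: "j \<in> {1..t}"
      and eq: "y (int (n - i)) = a j (n - i - 1) - y (int (n - i) - int j)"
      by blast
    have idx: "int (n - i) = int n - int i" "int n - int i - int j = int n - int (i + j)"
      "n - i - 1 = n - 1 - i"
      using n i by auto
    have step: "y (int n) \<ge> y (int n - int (i + j)) + a i (n - 1) - a j (n - 1 - i)"
      using ineq[of n i] n i eq unfolding idx by simp
    have "\<not> i + j \<le> t"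
    proof
      assume "i + j \<le> t"
      then have ij: "i + j \<in> {1..t}"
        using i by simp
      have "- C \<le> y (int n) + y (int n - int (i + j))"
        using ineq[of n "i + j"] bound[OF ij, of "n - 1"] n ij by fastforce
      moreover have "y (int n - int (i + j)) \<le> y (int n) + 2 * C"
        using step bound[OF i, of "n - 1"] bound[OF j, of "n - 1 - i"] by linarith
      ultimately show False
        using neg C by linarith
    qed
    with j step show ?thesis
      by blast
  qed
  have one: "1 \<in> {1..t}"
    using i by simp
  have base: "y (int n - int (t + 1)) \<le> y (int n) + 2 * C"
  proof -
    from two_steps[OF one] obtain j where j: "j \<in> {1..t}" "\<not> 1 + j \<le> t"
      and step: "y (int n) \<ge> y (int n - int (1 + j)) + a 1 (n - 1) - a j (n - 1 - 1)"
      by blast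
    have "j = t"
      using j by auto
    with step bound[OF one, of "n - 1"] bound[OF j(1), of "n - 1 - 1"] show ?thesis
      by (simp add: add.commute)
  qed
  from two_steps[OF i] obtain j where j: "j \<in> {1..t}" "\<not> i + j \<le> t"
    and step: "y (int n) \<ge> y (int n - int (i + j)) + a i (n - 1) - a j (n - 1 - i)"
    by blast
  have "i + j = t + 1"
  proof (rule ccontr)
    assume "i + j \<noteq> t + 1"
    then have d: "i + j - (t + 1) \<in> {1..t}"
      using i j by auto
    have idx: "int (n - (t + 1)) = int n - int (t + 1)"
      "int n - int (t + 1) - int (i + j - (t + 1)) = int n - int (i + j)"
      using n j d by (auto simp: of_nat_diff)
    have "- C \<le> y (int n - int (t + 1)) + y (int n - int (i + j))"
      using ineq[of "n - (t + 1)" "i + j - (t + 1)"] bound[OF d, of "n - (t + 1) - 1"] n d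
      unfolding idx by fastforce
    moreover have "y (int n - int (i + j)) \<le> y (int n) + 2 * C"
      using step bound[OF i, of "n - 1"] bound[OF j(1), of "n - 1 - i"] by linarith
    ultimately show False
      using base neg C by linarith
  qed
  moreover from this have "j = t + 1 - i"
    by simp
  ultimately show ?thesis
    using step by simp
qed

lemma additive_solution_bounded_below:
  fixes y :: "int \<Rightarrow> real" and a :: "nat \<Rightarrow> nat \<Rightarrow> real"
  assumes ineq: "\<And>n i. n \<ge> 1 \<Longrightarrow> i \<in> {1..t} \<Longrightarrow> a i (n - 1) \<le> y (int n) + y (int n - int i)"
    and attained: "\<And>n. n \<ge> 1 \<Longrightarrow> \<exists>i\<in>{1..t}. y (int n) = a i (n - 1) - y (int n - int i)"
    and bound: "\<And>i n. i \<in> {1..t} \<Longrightarrow> \<bar>a i n\<bar> \<le> C"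
    and period: "\<And>i. i \<in> {1..t} \<Longrightarrow> is_period (a i) (p i)"
    and copr: "\<exists>i\<in>{1..t}. coprime (t + 1) (p i) \<and> coprime (t + 1) (p (t + 1 - i))"
  obtains L where "\<And>n. n \<ge> 1 \<Longrightarrow> L \<le> y (int n)"
proof -
  define \<mu> where "\<mu> i = (\<Sum>k<p i. a i k) / real (p i)" for i
  obtain i where i: "i \<in> {1..t}" and cop: "coprime (t + 1) (p i)" "coprime (t + 1) (p (t + 1 - i))"
    and mean: "\<mu> (t + 1 - i) \<le> \<mu> i"
  proof -
    obtain i where i: "i \<in> {1..t}" "coprime (t + 1) (p i)" "coprime (t + 1) (p (t + 1 - i))"
      using copr by blast
    then have "t + 1 - i \<in> {1..t}" "t + 1 - (t + 1 - i) = i"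
      by auto
    with i that[of i] that[of "t + 1 - i"] show thesis
      by (metis linear)
  qed
  then have i': "t + 1 - i \<in> {1..t}"
    by auto
  obtain \<phi> B where \<phi>: "\<And>n. \<phi> (n + (t + 1)) = \<phi> n + a i n - \<mu> i" "\<And>n. \<bar>\<phi> n\<bar> \<le> B"
    using bounded_potential_of_periodic[OF period[OF i] cop(1)] unfolding \<mu>_def by blast
  obtain \<phi>' B' where \<phi>': "\<And>n. \<phi>' (n + (t + 1)) = \<phi>' n + a (t + 1 - i) n - \<mu> (t + 1 - i)"
      "\<And>n. \<bar>\<phi>' n\<bar> \<le> B'"
    using bounded_potential_of_periodic[OF period[OF i'] cop(2)] unfolding \<mu>_def by blast
  \<comment> \<open>The arguments are those of the coefficients in the descent from \<open>n + (t + 1)\<close> to \<open>n\<close>,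
    namely \<open>a i (n + t)\<close> and \<open>a (t + 1 - i) (n + t - i)\<close>.\<close>
  define \<psi> where "\<psi> n = \<phi> (n + t) - \<phi>' (n + t - i)" for n
  have \<psi>_bound: "\<bar>\<psi> n\<bar> \<le> B + B'" for n
    using \<phi>(2)[of "n + t"] \<phi>'(2)[of "n + t - i"] by (simp add: \<psi>_def)
  have \<psi>_step: "\<psi> (n + (t + 1)) - \<psi> n \<le> a i (n + t) - a (t + 1 - i) (n + t - i)" for n
  proof -
    have "n + (t + 1) + t = n + t + (t + 1)" "n + (t + 1) + t - i = n + t - i + (t + 1)"
      using i by auto
    then show ?thesis
      using \<phi>(1)[of "n + t"] \<phi>'(1)[of "n + t - i"] mean by (simp only: \<psi>_def)
  qed
  define L where "L = Min (insert (- 3 * C) ((\<lambda>n. y (int n)) ` {1..t + 1})) - (B + B')"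
  have L: "L + (B + B') \<le> - 3 * C" "\<And>n. n \<in> {1..t + 1} \<Longrightarrow> L + (B + B') \<le> y (int n)"
    unfolding L_def by (simp, simp only: diff_add_cancel, intro Min_le, auto)
  \<comment> \<open>Adding \<open>\<psi>\<close>, which follows the fluctuation of the increments, is what makes the bound
    pass from \<open>n - (t + 1)\<close> to \<open>n\<close> without loss.\<close>
  have main: "L + \<psi> n \<le> y (int n)" if "n \<ge> 1" for n
    using that
  proof (induction n rule: less_induct)
    case (less n)
    consider "n \<le> t + 1" | "y (int n) \<ge> - 3 * C" | "n \<ge> t + 2" "y (int n) < - 3 * C"
      by linarith
    then show ?case
    proof cases
      case 1
      then show ?thesis
        using L(2)[of n] less.prems \<psi>_bound[of n] by auto
    next
      case 2
      then show ?thesis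
        using L(1) \<psi>_bound[of n] by linarith
    next
      case 3
      define m where "m = n - (t + 1)"
      have m: "n = m + (t + 1)" "m \<ge> 1" "n - 1 = m + t" "n - 1 - i = m + t - i"
          "int n - int (t + 1) = int m"
        using 3(1) by (auto simp: m_def)
      have "L + \<psi> m \<le> y (int m)"
        using less.IH[of m] m by simp
      moreover have "y (int n) \<ge> y (int m) + a i (m + t) - a (t + 1 - i) (m + t - i)"
        using controlled_descent_from_very_negative[OF ineq attained bound 3(1) i 3(2)]
        unfolding m(3-5) by simp
      ultimately show ?thesis
        using \<psi>_step[of m] m(1) by simp
    qed
  qed
  show thesis
  proof (rule that)
    fix n :: nat
    assume "n \<ge> 1"
    then show "L - (B + B') \<le> y (int n)"
      using main[of n] \<psi>_bound[of n] by linarith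
  qed
qed

section \<open>Boundedness and persistence\<close>

theorem theorem9:
  fixes t :: nat
    and A :: "nat \<Rightarrow> nat \<Rightarrow> real"
    and p :: "nat \<Rightarrow> nat"
    and x :: "int \<Rightarrow> real"
  assumes "t \<ge> 1"
    and "\<And>i n. i \<in> {1..t} \<Longrightarrow> A i n > 0"
    and "\<And>i. i \<in> {1..t} \<Longrightarrow> prime_period (A i) (p i)"
    and "positive_solution t A x"
    and "\<exists>i\<in>{1..t}. gcd (t + 1) (p i * p (t + 1 - i)) = 1"
  shows "bounded_seq t x \<and> persists t x"
proof -
  define y where "y n = ln (x n)" for n
  define a where "a i n = ln (A i n)" for i n
  have x_pos: "x n > 0" if "n \<ge> - int t" for n
    using assms(4) that by (simp add: positive_solution_def)
  have rec: "x (int n) = Max ((\<lambda>i. A i (n - 1) / x (int n - int i)) ` {1..t})" if "n \<ge> 1" for n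
    using assms(4) that by (simp add: positive_solution_def)
  have pos: "x (int n) > 0" "x (int n - int i) > 0" "A i (n - 1) > 0" if "n \<ge> 1" "i \<in> {1..t}" for n i
    using that x_pos assms(2) by auto
  have ineq: "a i (n - 1) \<le> y (int n) + y (int n - int i)" if n: "n \<ge> 1" and i: "i \<in> {1..t}" for n i
  proof -
    have "A i (n - 1) / x (int n - int i) \<le> x (int n)"
      unfolding rec[OF n] using i by (intro Max_ge) auto
    then have "A i (n - 1) \<le> x (int n) * x (int n - int i)"
      using pos[OF n i] by (simp add: field_simps)
    then have "a i (n - 1) \<le> ln (x (int n) * x (int n - int i))"
      using pos[OF n i] by (simp add: a_def)
    also have "\<dots> = y (int n) + y (int n - int i)"
      using pos[OF n i] by (simp add: y_def ln_mult)
    finally show ?thesis .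
  qed
  have attained: "\<exists>i\<in>{1..t}. y (int n) = a i (n - 1) - y (int n - int i)" if n: "n \<ge> 1" for n
  proof -
    have "x (int n) \<in> (\<lambda>i. A i (n - 1) / x (int n - int i)) ` {1..t}"
      unfolding rec[OF n] using \<open>t \<ge> 1\<close> by (intro Max_in) auto
    then obtain i where i: "i \<in> {1..t}" "x (int n) = A i (n - 1) / x (int n - int i)"
      by blast
    then have "y (int n) = a i (n - 1) - y (int n - int i)"
      using pos[OF n i(1)] by (simp add: y_def a_def ln_div)
    with i(1) show ?thesis
      by blast
  qed
  have period: "is_period (a i) (p i)" if "i \<in> {1..t}" for i
    using assms(3)[OF that] by (simp add: prime_period_def is_period_def a_def)
  obtain C where C: "\<And>i n. i \<in> {1..t} \<Longrightarrow> \<bar>a i n\<bar> \<le> C"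
  proof
    have "finite (abs ` (\<Union>i\<in>{1..t}. range (a i)))"
      using finite_range_of_period[OF period] by simp
    then show "\<bar>a i n\<bar> \<le> Max (abs ` (\<Union>i\<in>{1..t}. range (a i)))" if "i \<in> {1..t}" for i n
      using that by (intro Max_ge imageI UN_I[of i]) auto
  qed
  have "\<exists>i\<in>{1..t}. coprime (t + 1) (p i) \<and> coprime (t + 1) (p (t + 1 - i))"
    using assms(5) by (metis coprime_iff_gcd_eq_1 coprime_mult_right_iff)
  from additive_solution_bounded_below[OF ineq attained C period this]
  obtain L where L: "\<And>n. n \<ge> 1 \<Longrightarrow> L \<le> y (int n)"
    by blast
  define l where "l = Min (insert L (y ` {- int t..0}))"
  have lower: "l \<le> y n" if "n \<ge> - int t" for n
  proof (cases "n \<le> 0")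
    case True
    then show ?thesis
      using that unfolding l_def by (intro Min_le) auto
  next
    case False
    then have "L \<le> y n"
      using L[of "nat n"] by simp
    moreover have "l \<le> L"
      by (simp add: l_def)
    ultimately show ?thesis
      by simp
  qed
  define u where "u = Max (insert (C - l) (y ` {- int t..0}))"
  have upper: "y n \<le> u" if "n \<ge> - int t" for n
  proof (cases "n \<le> 0")
    case True
    then show ?thesis
      using that unfolding u_def by (intro Max_ge) auto
  next
    case False
    then have n: "nat n \<ge> 1" "int (nat n) = n"
      by auto
    from attained[OF n(1)] obtain i where i: "i \<in> {1..t}" "y n = a i (nat n - 1) - y (n - int i)"
      unfolding n(2) by blast
    then have "y n \<le> C - l"
      using C[OF i(1), of "nat n - 1"] lower[of "n - int i"] False by simp
    moreover have "C - l \<le> u"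
      by (simp add: u_def)
    ultimately show ?thesis
      by simp
  qed
  have "exp l \<le> x n" "x n \<le> exp u" if "n \<ge> - int t" for n
  proof -
    have "x n = exp (y n)"
      using x_pos[OF that] by (simp add: y_def)
    with lower[OF that] upper[OF that] show "exp l \<le> x n" "x n \<le> exp u"
      by simp_all
  qed
  then have "\<forall>n \<ge> - int t. 0 < x n \<and> x n \<le> exp u" "\<forall>n \<ge> - int t. exp l \<le> x n"
    using x_pos by simp_all
  then show ?thesis
    unfolding bounded_seq_def persists_def using exp_gt_zero by blast
qed

end
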